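(* Let $O$ be a set of Boolean functions. The following are equivalent: (1) $O\preceq\{\land,\lor,\top,\bot\}$ or $O\preceq\{\neg,\bot\}$. (2) Every formula $\phi\in\mathrm{PL}_O$ is uniquely characterized with respect to $\mathrm{PL}_O$ by a finite set of labeled examples. (3) There is a function $f:\mathbb{N}\to\mathbb{N}$ such that for all finite sets $\textsc{prop}$ of propositional variables, every $\phi\in\mathrm{PL}_O[\textsc{prop}]$ is uniquely characterized with respect to $\mathrm{PL}_O[\textsc{prop}]$ by a set of $f(|\phi|_{\mathrm{dag}})$ labeled examples.
   Context: A Boolean function is a map $\{0,1\}^n\to\{0,1\}$ with $n\ge 1$; the constants $\top,\bot$ are treated as constant unary Boolean functions. $\land,\lor,\neg$ denote the usual Boolean functions $x\land y$, $x\lor y$, $\neg x$. For a set $O$ of Boolean functions, $\langle O\rangle$ (the clone generated by $O$) is the smallest set of Boolean functions containing $O$ and all projections $\pi^n_k(x_1,\dots,x_n)=x_k$ and closed under composition; $O\preceq O'$ means $\langle O\rangle\subseteq\langle O'\rangle$. Fix a countably infinite set of propositional variables. $\mathrm{PL}_O$ is the set of formulas generated by $\phi::=x\mid f(\phi_1,\dots,\phi_n)$ with $x$ a propositional variable and $f\in O$ of arity $n$; $\mathrm{PL}_O[\textsc{prop}]$ consists of the $\mathrm{PL}_O$-formulas using only variables from $\textsc{prop}$. Given a truth assignment $V$, $[\![x]\!]_V=V(x)$ and $[\![f(\phi_1,\dots,\phi_n)]\!]_V=f([\![\phi_1]\!]_V,\dots,[\![\phi_n]\!]_V)$; two formulas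 are equivalent if they have the same value under every assignment. $|\phi|_{\mathrm{dag}}$ is the number of distinct subformulas of $\phi$. A labeled example is a pair $(V,\mathrm{lab})$ with $V$ a truth assignment and $\mathrm{lab}\in\{0,1\}$; $\phi$ fits it if $[\![\phi]\!]_V=\mathrm{lab}$. A set $E$ of labeled examples uniquely characterizes $\phi$ with respect to a set of formulas $L$ (here $L=\mathrm{PL}_O$ or $L=\mathrm{PL}_O[\textsc{prop}]$) if $\phi$ fits every example in $E$ and every formula of $L$ fitting every example in $E$ is equivalent to $\phi$. *)

theory Defs
  imports Main
begin

text \<open>A Boolean function of arity n is represented by the pair (n, f) where
  f takes the argument tuple as a list of length n.  To make the representation
  canonical, f is required to be False on lists of any other length.\<close>

type_synonym bfun = "nat \<times> (bool list \<Rightarrow> bool)"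

definition is_bfun :: "bfun \<Rightarrow> bool" where
  "is_bfun F \<longleftrightarrow> fst F \<ge> 1 \<and> (\<forall>xs. length xs \<noteq> fst F \<longrightarrow> snd F xs = False)"

definition BF :: "bfun set" where
  "BF = {F. is_bfun F}"

definition proj_bf :: "nat \<Rightarrow> nat \<Rightarrow> bfun" where
  "proj_bf n k = (n, \<lambda>xs. if length xs = n then xs ! k else False)"

definition comp_bf :: "bfun \<Rightarrow> nat \<Rightarrow> bfun list \<Rightarrow> bfun" where
  "comp_bf F m Gs = (m, \<lambda>xs. if length xs = m then snd F (map (\<lambda>G. snd G xs) Gs) else False)"

inductive_set clone :: "bfun set \<Rightarrow> bfun set" for Ops :: "bfun set" where
  base: "F \<in> Ops \<Longrightarrow> F \<in> clone Ops"
| proj: "1 \<le> n \<Longrightarrow> k < n \<Longrightarrow> proj_bf n k \<in> clone Ops"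
| comp: "F \<in> clone Ops \<Longrightarrow> length Gs = fst F \<Longrightarrow> 1 \<le> m \<Longrightarrow>
         (\<forall>G \<in> set Gs. G \<in> clone Ops \<and> fst G = m) \<Longrightarrow> comp_bf F m Gs \<in> clone Ops"

definition clone_le :: "bfun set \<Rightarrow> bfun set \<Rightarrow> bool" (infix "\<preceq>\<^sub>c" 50) where
  "Ops \<preceq>\<^sub>c Ops' \<longleftrightarrow> clone Ops \<subseteq> clone Ops'"

definition and_bf :: bfun where
  "and_bf = (2, \<lambda>xs. if length xs = 2 then xs ! 0 \<and> xs ! 1 else False)"
definition or_bf :: bfun where
  "or_bf = (2, \<lambda>xs. if length xs = 2 then xs ! 0 \<or> xs ! 1 else False)"
definition neg_bf :: bfun where
  "neg_bf = (1, \<lambda>xs. if length xs = 1 then \<not> xs ! 0 else False)"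
definition top_bf :: bfun where
  "top_bf = (1, \<lambda>xs. length xs = 1)"
definition bot_bf :: bfun where
  "bot_bf = (1, \<lambda>xs. False)"

datatype form = Var nat | App bfun "form list"

fun eval :: "(nat \<Rightarrow> bool) \<Rightarrow> form \<Rightarrow> bool" where
  "eval V (Var x) = V x"
| "eval V (App F args) = snd F (map (eval V) args)"

fun vars :: "form \<Rightarrow> nat set" where
  "vars (Var x) = {x}"
| "vars (App F args) = \<Union> (set (map vars args))"

fun wf_form :: "bfun set \<Rightarrow> form \<Rightarrow> bool" where
  "wf_form Ops (Var x) = True"
| "wf_form Ops (App F args) = (F \<in> Ops \<and> length args = fst F \<and> (\<forall>a \<in> set args. wf_form Ops a))"

definition PL :: "bfun set \<Rightarrow> form set" where
  "PL Ops = {\<phi>. wf_form Ops \<phi>}"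

definition PL_prop :: "bfun set \<Rightarrow> nat set \<Rightarrow> form set" where
  "PL_prop Ops P = {\<phi>. wf_form Ops \<phi> \<and> vars \<phi> \<subseteq> P}"

fun subformulas :: "form \<Rightarrow> form set" where
  "subformulas (Var x) = {Var x}"
| "subformulas (App F args) = insert (App F args) (\<Union> (set (map subformulas args)))"

definition dag_size :: "form \<Rightarrow> nat" where
  "dag_size \<phi> = card (subformulas \<phi>)"

definition equiv_form :: "form \<Rightarrow> form \<Rightarrow> bool" where
  "equiv_form \<phi> \<psi> \<longleftrightarrow> (\<forall>V. eval V \<phi> = eval V \<psi>)"

type_synonym example = "(nat \<Rightarrow> bool) \<times> bool"

definition fits :: "form \<Rightarrow> example \<Rightarrow> bool" where
  "fits \<phi> e \<longleftrightarrow> eval (fst e) \<phi> = snd e"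

definition uniquely_characterizes :: "example set \<Rightarrow> form \<Rightarrow> form set \<Rightarrow> bool" where
  "uniquely_characterizes E \<phi> L \<longleftrightarrow>
     (\<forall>e \<in> E. fits \<phi> e) \<and> (\<forall>\<psi> \<in> L. (\<forall>e \<in> E. fits \<psi> e) \<longrightarrow> equiv_form \<psi> \<phi>)"

end

theory Submission
  imports Defs
begin

text \<open>If all formulas are monotone, or all depend on at most one variable, then \<open>\<phi>\<close> is characterized
  by the assignments that are arbitrary on its variables and constant elsewhere.

  Otherwise the formulas define an operation \<open>h\<close> such that \<open>h u p p w\<close> does not depend on \<open>p\<close>
  although \<open>h u p q w\<close> differs from it. (Post's lattice would give \<open>x + y + z\<close>, \<open>x \<and> (y \<or> \<not> z)\<close> or
  \<open>x \<or> (y \<and> \<not> z)\<close>; this weaker property has a short direct proof.) Among many fresh variables,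
  finitely many examples cannot separate some two, say \<open>p\<close> and \<open>q\<close>, and then \<open>h u p q w\<close> fits the same
  examples as \<open>h u v v w\<close> for a variable \<open>v\<close> fixed in advance.\<close>

section \<open>Formulas\<close>

lemma finite_vars: "finite (vars \<phi>)"
  by (induction \<phi>) auto

lemma eval_cong: "(\<And>x. x \<in> vars \<phi> \<Longrightarrow> V x = W x) \<Longrightarrow> eval V \<phi> = eval W \<phi>"
proof (induction \<phi>)
  case (App F args)
  then have "map (eval V) args = map (eval W) args" by auto
  then show ?case by (metis eval.simps(2))
qed auto

lemma finite_subformulas: "finite (subformulas \<phi>)"
  by (induction \<phi>) auto

lemma Var_in_subformulas: "x \<in> vars \<phi> \<Longrightarrow> Var x \<in> subformulas \<phi>"
  by (induction \<phi>) auto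

lemma card_vars_le_dag_size: "card (vars \<phi>) \<le> dag_size \<phi>"
proof -
  have "card (vars \<phi>) = card (Var ` vars \<phi>)"
    by (simp add: card_image inj_on_def)
  also have "\<dots> \<le> card (subformulas \<phi>)"
    by (intro card_mono finite_subformulas) (auto simp: Var_in_subformulas)
  finally show ?thesis by (simp add: dag_size_def)
qed

section \<open>Substitution and essential variables\<close>

fun subst_form :: "(nat \<Rightarrow> form) \<Rightarrow> form \<Rightarrow> form" where
  "subst_form \<sigma> (Var x) = \<sigma> x"
| "subst_form \<sigma> (App F args) = App F (map (subst_form \<sigma>) args)"

lemma eval_subst_form: "eval V (subst_form \<sigma> \<phi>) = eval (\<lambda>x. eval V (\<sigma> x)) \<phi>"
proof (induction \<phi>)
  case (App F args)
  then have "map (eval V \<circ> subst_form \<sigma>) args = map (eval (\<lambda>x. eval V (\<sigma> x))) args"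
    by auto
  then show ?case by (metis subst_form.simps(2) eval.simps(2) map_map)
qed auto

lemma vars_subst_form: "vars (subst_form \<sigma> \<phi>) = (\<Union>x\<in>vars \<phi>. vars (\<sigma> x))"
  by (induction \<phi>) auto

lemma wf_subst_form: "wf_form Ops \<phi> \<Longrightarrow> (\<And>x. wf_form Ops (\<sigma> x)) \<Longrightarrow> wf_form Ops (subst_form \<sigma> \<phi>)"
  by (induction \<phi>) auto

lemma Var_in_PL: "Var x \<in> PL Ops"
  by (simp add: PL_def)

lemma subst_form_in_PL: "\<phi> \<in> PL Ops \<Longrightarrow> (\<And>x. \<sigma> x \<in> PL Ops) \<Longrightarrow> subst_form \<sigma> \<phi> \<in> PL Ops"
  by (simp add: PL_def wf_subst_form)

text \<open>Pass from \<open>a\<close> to \<open>b\<close> one variable of \<phi> at a time. The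
  value changes somewhere on this finite path, and the step where it changes supplies both
  \<open>i\<close> and \<open>c\<close>.\<close>

lemma eval_depends_on_variable:
  assumes "eval a \<phi> \<noteq> eval b \<phi>"
  obtains i c where "a i \<noteq> b i" "eval c \<phi> \<noteq> eval (c(i := \<not> c i)) \<phi>"
proof -
  \<comment> \<open>Induction on a set \<open>D\<close> containing every variable of \<phi> on which
    \<open>a\<close> and \<open>b\<close> may still differ; each step moves one coordinate of
    \<open>a\<close> to its value in \<open>b\<close>.\<close>
  have "\<exists>i c. a i \<noteq> b i \<and> eval c \<phi> \<noteq> eval (c(i := \<not> c i)) \<phi>"
    if "finite D" "\<forall>x\<in>vars \<phi> - D. a x = b x" "eval a \<phi> \<noteq> eval b \<phi>" for D a
    using that
  proof (induction D arbitrary: a rule: finite_induct)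
    case empty
    then show ?case using eval_cong[of \<phi> a b] by auto
  next
    case (insert i D)
    show ?case
    proof (cases "eval (a(i := b i)) \<phi> = eval b \<phi>")
      case True
      with insert.prems(2) have ne: "eval a \<phi> \<noteq> eval (a(i := b i)) \<phi>" by simp
      have i: "a i \<noteq> b i"
      proof
        assume "a i = b i"
        then have "a(i := b i) = a" by (rule fun_upd_idem)
        with ne show False by simp
      qed
      then have "b i = (\<not> a i)" by auto
      with ne have "eval a \<phi> \<noteq> eval (a(i := \<not> a i)) \<phi>" by simp
      with i show ?thesis by (intro exI conjI)
    next
      case False
      have "\<forall>x\<in>vars \<phi> - D. (a(i := b i)) x = b x" using insert.prems(1) by auto
      from insert.IH[OF this False] obtain j c
        where "(a(i := b i)) j \<noteq> b j" and c: "eval c \<phi> \<noteq> eval (c(j := \<not> c j)) \<phi>"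
        by (elim exE conjE)
      then have "a j \<noteq> b j" by (auto split: if_splits)
      with c show ?thesis by (intro exI conjI)
    qed
  qed
  from this[OF finite_vars, of \<phi> a] assms have "\<exists>i c. a i \<noteq> b i \<and> eval c \<phi> \<noteq> eval (c(i := \<not> c i)) \<phi>"
    by simp
  then show thesis by (elim exE conjE) (rule that)
qed

section \<open>Monotone formulas and formulas of at most one essential variable\<close>

definition mono_form :: "form \<Rightarrow> bool" where
  "mono_form \<phi> \<longleftrightarrow> (\<forall>a b. (\<forall>x. a x \<longrightarrow> b x) \<longrightarrow> eval a \<phi> \<longrightarrow> eval b \<phi>)"

lemma mono_formD: "mono_form \<phi> \<Longrightarrow> (\<And>x. a x \<Longrightarrow> b x) \<Longrightarrow> eval a \<phi> \<Longrightarrow> eval b \<phi>"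
  unfolding mono_form_def by blast

definition unary_form :: "form \<Rightarrow> bool" where
  "unary_form \<phi> \<longleftrightarrow> (\<exists>k g. \<forall>V. eval V \<phi> = g (V k))"

text \<open>No single coordinate determines the value. A first change of value gives an essential
  \<open>i\<close>; a change between two assignments that agree at \<open>i\<close> gives a second
  essential variable, necessarily different. The witnesses \<open>a\<close> and \<open>b\<close>
  need not be related.\<close>

lemma not_unary_form_depends:
  assumes "\<not> unary_form \<phi>"
  obtains i j a b where "i \<noteq> j" "eval a \<phi> \<noteq> eval (a(i := \<not> a i)) \<phi>" "eval b \<phi> \<noteq> eval (b(j := \<not> b j)) \<phi>"
proof -
  have ex: "\<exists>V W. V k = W k \<and> eval V \<phi> \<noteq> eval W \<phi>" for k
  proof (rule ccontr)
    assume "\<not> ?thesis"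
    then have *: "eval V \<phi> = eval W \<phi>" if "V k = W k" for V W
      using that by metis
    have "\<forall>V. eval V \<phi> = (\<lambda>c. eval (\<lambda>_. c) \<phi>) (V k)"
      by (intro allI) (rule *, simp)
    then have "unary_form \<phi>" unfolding unary_form_def by (intro exI)
    with assms show False by simp
  qed
  obtain V W where "eval V \<phi> \<noteq> eval W \<phi>" using ex by blast
  then obtain i a where i: "eval a \<phi> \<noteq> eval (a(i := \<not> a i)) \<phi>"
    by (rule eval_depends_on_variable)
  obtain V' W' where VW: "V' i = W' i" "eval V' \<phi> \<noteq> eval W' \<phi>" using ex[of i] by (elim exE conjE)
  from VW(2) obtain j b where "V' j \<noteq> W' j" "eval b \<phi> \<noteq> eval (b(j := \<not> b j)) \<phi>"
    by (rule eval_depends_on_variable)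
  moreover from this VW(1) have "i \<noteq> j" by auto
  ultimately show thesis using i that by simp
qed

section \<open>The two clones\<close>

lemma clone_le_iff_subset: "A \<preceq>\<^sub>c B \<longleftrightarrow> A \<subseteq> clone B"
proof
  assume "A \<subseteq> clone B"
  have "F \<in> clone B" if "F \<in> clone A" for F
    using that
  proof induction
    case (comp F Gs m)
    then show ?case by (intro clone.comp) auto
  qed (use \<open>A \<subseteq> clone B\<close> in \<open>auto intro: clone.intros\<close>)
  then show "A \<preceq>\<^sub>c B" by (auto simp: clone_le_def)
qed (auto simp: clone_le_def intro: clone.base)

definition mono_bf :: "bfun \<Rightarrow> bool" where
  "mono_bf F \<longleftrightarrow> (\<forall>xs ys. length xs = fst F \<longrightarrow> list_all2 (\<longrightarrow>) xs ys \<longrightarrow> snd F xs \<longrightarrow> snd F ys)"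

lemma mono_bfD: "mono_bf F \<Longrightarrow> length xs = fst F \<Longrightarrow> list_all2 (\<longrightarrow>) xs ys \<Longrightarrow> snd F xs \<Longrightarrow> snd F ys"
  unfolding mono_bf_def by blast

definition unary_bf :: "bfun \<Rightarrow> bool" where
  "unary_bf F \<longleftrightarrow> (\<exists>k<fst F. \<exists>g. \<forall>xs. length xs = fst F \<longrightarrow> snd F xs = g (xs ! k))"

abbreviation (input) "mono_basis \<equiv> {and_bf, or_bf, top_bf, bot_bf}"
abbreviation (input) "unary_basis \<equiv> {neg_bf, bot_bf}"

lemma mono_basis_clone_mono: "F \<in> clone mono_basis \<Longrightarrow> mono_bf F"
proof (induction rule: clone.induct)
  case (base F)
  then show ?case
    by (auto simp: mono_bf_def and_bf_def or_bf_def top_bf_def bot_bf_def list_all2_conv_all_nth)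
next
  case (proj n k)
  then show ?case by (auto simp: mono_bf_def proj_bf_def list_all2_conv_all_nth)
next
  case (comp F Gs m)
  show ?case unfolding mono_bf_def
  proof (intro allI impI)
    fix xs ys :: "bool list"
    assume l: "length xs = fst (comp_bf F m Gs)" and le: "list_all2 (\<longrightarrow>) xs ys"
      and t: "snd (comp_bf F m Gs) xs"
    have "list_all2 (\<longrightarrow>) (map (\<lambda>G. snd G xs) Gs) (map (\<lambda>G. snd G ys) Gs)"
      unfolding list.rel_map
    proof (rule list.rel_refl_strong)
      fix G assume "G \<in> set Gs"
      with comp(5) l have "mono_bf G" "length xs = fst G" by (auto simp: comp_bf_def)
      with le show "snd G xs \<longrightarrow> snd G ys" using mono_bfD by blast
    qed
    then show "snd (comp_bf F m Gs) ys"
      using mono_bfD[OF comp(4), of "map (\<lambda>G. snd G xs) Gs"] comp(2) l t list_all2_lengthD[OF le]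
      by (simp add: comp_bf_def)
  qed
qed

lemma unary_basis_clone_unary: "F \<in> clone unary_basis \<Longrightarrow> unary_bf F"
proof (induction rule: clone.induct)
  case (base F)
  then show ?case
  proof
    assume "F = neg_bf"
    then show ?thesis unfolding unary_bf_def neg_bf_def
      by (intro exI[of _ 0] conjI exI[of _ Not]) auto
  next
    assume "F \<in> {bot_bf}"
    then show ?thesis unfolding unary_bf_def bot_bf_def
      by (intro exI[of _ 0] conjI exI[of _ "\<lambda>_. False"]) auto
  qed
next
  case (proj n k)
  then show ?case unfolding unary_bf_def proj_bf_def
    by (intro exI[of _ k] conjI exI[of _ "\<lambda>c. c"]) auto
next
  case (comp F Gs m)
  from comp(4) obtain k g where k: "k < fst F" and g: "\<And>xs. length xs = fst F \<Longrightarrow> snd F xs = g (xs ! k)"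
    unfolding unary_bf_def by blast
  have "Gs ! k \<in> set Gs" using k comp(2) by auto
  with comp(5) obtain k' g' where k': "k' < m" and g': "\<And>xs. length xs = m \<Longrightarrow> snd (Gs ! k) xs = g' (xs ! k')"
    unfolding unary_bf_def by metis
  show ?case unfolding unary_bf_def
    by (rule exI[of _ k'], intro conjI exI[of _ "\<lambda>c. g (g' c)"])
      (use k k' g g' comp(2) in \<open>auto simp: comp_bf_def\<close>)
qed

section \<open>Generating monotone and essentially unary functions from the bases\<close>

lemma nary_top_in_mono_clone:
  assumes "n \<ge> 1"
  shows "(n, \<lambda>xs. length xs = n) \<in> clone mono_basis"
proof -
  have "comp_bf top_bf n [proj_bf n 0] \<in> clone mono_basis"
    using assms clone.proj[of n 0 mono_basis]
    by (intro clone.comp clone.base) (auto simp: top_bf_def proj_bf_def)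
  moreover have "comp_bf top_bf n [proj_bf n 0] = (n, \<lambda>xs. length xs = n)"
    by (auto simp: comp_bf_def top_bf_def)
  ultimately show ?thesis by simp
qed

lemma nary_bot_in_clone:
  assumes "bot_bf \<in> B" "n \<ge> 1"
  shows "(n, \<lambda>xs. False) \<in> clone B"
proof -
  have "comp_bf bot_bf n [proj_bf n 0] \<in> clone B"
    using assms clone.proj[of n 0 B] by (intro clone.comp clone.base) (auto simp: bot_bf_def proj_bf_def)
  moreover have "comp_bf bot_bf n [proj_bf n 0] = (n, \<lambda>xs. False)"
    by (auto simp: comp_bf_def bot_bf_def)
  ultimately show ?thesis by simp
qed

lemma conj_in_mono_clone:
  assumes "(n, f) \<in> clone mono_basis" "(n, g) \<in> clone mono_basis" "n \<ge> 1"
  shows "(n, \<lambda>xs. length xs = n \<and> f xs \<and> g xs) \<in> clone mono_basis"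
proof -
  have "comp_bf and_bf n [(n, f), (n, g)] \<in> clone mono_basis"
    using assms by (intro clone.comp clone.base) (auto simp: and_bf_def)
  moreover have "comp_bf and_bf n [(n, f), (n, g)] = (n, \<lambda>xs. length xs = n \<and> f xs \<and> g xs)"
    by (auto simp: comp_bf_def and_bf_def)
  ultimately show ?thesis by simp
qed

lemma disj_in_mono_clone:
  assumes "(n, f) \<in> clone mono_basis" "(n, g) \<in> clone mono_basis" "n \<ge> 1"
  shows "(n, \<lambda>xs. length xs = n \<and> (f xs \<or> g xs)) \<in> clone mono_basis"
proof -
  have "comp_bf or_bf n [(n, f), (n, g)] \<in> clone mono_basis"
    using assms by (intro clone.comp clone.base) (auto simp: or_bf_def)
  moreover have "comp_bf or_bf n [(n, f), (n, g)] = (n, \<lambda>xs. length xs = n \<and> (f xs \<or> g xs))"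
    by (auto simp: comp_bf_def or_bf_def)
  ultimately show ?thesis by simp
qed

lemma big_conj_in_mono_clone:
  assumes "finite S" "S \<subseteq> {..<n}" "n \<ge> 1"
  shows "(n, \<lambda>xs. length xs = n \<and> (\<forall>k\<in>S. xs ! k)) \<in> clone mono_basis"
  using assms
proof (induction S rule: finite_induct)
  case empty
  then show ?case using nary_top_in_mono_clone by simp
next
  case (insert k S)
  have "(n, \<lambda>xs. if length xs = n then xs ! k else False) \<in> clone mono_basis"
    using clone.proj[of n k] insert.prems by (simp add: proj_bf_def)
  from conj_in_mono_clone[OF this insert.IH] insert.prems
  have "(n, \<lambda>xs. length xs = n \<and> (if length xs = n then xs ! k else False) \<and>
      length xs = n \<and> (\<forall>k\<in>S. xs ! k)) \<in> clone mono_basis" by simp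
  also have "(\<lambda>xs. length xs = n \<and> (if length xs = n then xs ! k else False) \<and>
      length xs = n \<and> (\<forall>k\<in>S. xs ! k)) = (\<lambda>xs. length xs = n \<and> (\<forall>k\<in>insert k S. xs ! k))"
    by auto
  finally show ?case .
qed

lemma big_disj_in_mono_clone:
  assumes "finite A" "n \<ge> 1" "\<And>a. a \<in> A \<Longrightarrow> (n, f a) \<in> clone mono_basis"
  shows "(n, \<lambda>xs. length xs = n \<and> (\<exists>a\<in>A. f a xs)) \<in> clone mono_basis"
  using assms
proof (induction A rule: finite_induct)
  case empty
  then show ?case using nary_bot_in_clone by simp
next
  case (insert a A)
  then have "(n, \<lambda>xs. length xs = n \<and> (f a xs \<or> length xs = n \<and> (\<exists>a\<in>A. f a xs))) \<in> clone mono_basis"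
    by (intro disj_in_mono_clone) auto
  also have "(\<lambda>xs. length xs = n \<and> (f a xs \<or> length xs = n \<and> (\<exists>a\<in>A. f a xs))) =
      (\<lambda>xs. length xs = n \<and> (\<exists>a\<in>insert a A. f a xs))"
    by auto
  finally show ?case .
qed

text \<open>Disjunctive normal form without negations: \<open>F\<close> is the disjunction, over its
  true points \<open>a\<close>, of the conjunction of the arguments true in \<open>a\<close>. Such a
  conjunction holds exactly at the points above \<open>a\<close>, where \<open>F\<close> is true by
  monotonicity.\<close>

lemma mono_bf_in_clone:
  assumes "is_bfun F" "mono_bf F"
  shows "F \<in> clone mono_basis"
proof -
  define n where "n = fst F"
  define A where "A = {a. length a = n \<and> snd F a}"
  have n: "n \<ge> 1" using assms(1) by (simp add: is_bfun_def n_def)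
  have "finite A"
    by (rule finite_subset[OF _ finite_lists_length_eq[of UNIV n]]) (auto simp: A_def)
  then have "(n, \<lambda>xs. length xs = n \<and> (\<exists>a\<in>A. length xs = n \<and> (\<forall>k\<in>{k. k < n \<and> a ! k}. xs ! k)))
      \<in> clone mono_basis"
    using n by (intro big_disj_in_mono_clone big_conj_in_mono_clone) auto
  also have "(\<lambda>xs. length xs = n \<and> (\<exists>a\<in>A. length xs = n \<and> (\<forall>k\<in>{k. k < n \<and> a ! k}. xs ! k))) = snd F"
  proof
    fix xs
    have "\<exists>a\<in>A. \<forall>k. k < n \<and> a ! k \<longrightarrow> xs ! k" if "length xs = n" "snd F xs"
      using that by (auto simp: A_def)
    moreover have "snd F xs" if "length xs = n" "a \<in> A" "\<forall>k. k < n \<and> a ! k \<longrightarrow> xs ! k" for a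
    proof -
      have "list_all2 (\<longrightarrow>) a xs" using that by (auto simp: list_all2_conv_all_nth A_def)
      with assms(2) that(2) show ?thesis by (auto simp: mono_bf_def A_def n_def)
    qed
    moreover have "length xs = n" if "snd F xs"
      using assms(1) that by (auto simp: is_bfun_def n_def)
    ultimately show "(length xs = n \<and> (\<exists>a\<in>A. length xs = n \<and> (\<forall>k\<in>{k. k < n \<and> a ! k}. xs ! k))) = snd F xs"
      by (auto 0 3)
  qed
  finally show ?thesis by (simp add: n_def)
qed

lemma neg_in_unary_clone:
  assumes "(n, f) \<in> clone unary_basis" "n \<ge> 1"
  shows "(n, \<lambda>xs. length xs = n \<and> \<not> f xs) \<in> clone unary_basis"
proof -
  have "comp_bf neg_bf n [(n, f)] \<in> clone unary_basis"
    using assms by (intro clone.comp clone.base) (auto simp: neg_bf_def)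
  moreover have "comp_bf neg_bf n [(n, f)] = (n, \<lambda>xs. length xs = n \<and> \<not> f xs)"
    by (auto simp: comp_bf_def neg_bf_def)
  ultimately show ?thesis by simp
qed

lemma unary_bf_in_clone:
  assumes "is_bfun F" "unary_bf F"
  shows "F \<in> clone unary_basis"
proof -
  define n where "n = fst F"
  have n: "n \<ge> 1" and len: "\<And>xs. snd F xs \<Longrightarrow> length xs = n"
    using assms(1) by (auto simp: is_bfun_def n_def)
  from assms(2) obtain k g where k: "k < n" and g: "\<And>xs. length xs = n \<Longrightarrow> snd F xs = g (xs ! k)"
    by (auto simp: unary_bf_def n_def)
  have F: "F = (n, \<lambda>xs. length xs = n \<and> g (xs ! k))"
    using len g by (auto simp: n_def prod_eq_iff fun_eq_iff)
  have bot: "(n, \<lambda>xs. False) \<in> clone unary_basis"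
    using n by (simp add: nary_bot_in_clone)
  have pr: "(n, \<lambda>xs. length xs = n \<and> xs ! k) \<in> clone unary_basis"
    using clone.proj[OF n k, of unary_basis] by (simp add: proj_bf_def if_bool_eq_disj)
  \<comment> \<open>There are only four maps from \<open>bool\<close> to \<open>bool\<close>, and
    each gives a function built from a projection, \<bottom> and negation.\<close>
  consider "g = (\<lambda>_. False)" | "g = (\<lambda>_. True)" | "g = (\<lambda>c. c)" | "g = (\<lambda>c. \<not> c)"
    by (cases "g True"; cases "g False") (auto simp: fun_eq_iff all_bool_eq)
  then show ?thesis
  proof cases
    case 4
    have "(n, \<lambda>xs. length xs = n \<and> \<not> (length xs = n \<and> xs ! k)) \<in> clone unary_basis"
      by (rule neg_in_unary_clone[OF pr n])
    then show ?thesis using 4 F by (simp cong: conj_cong)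
  qed (use F bot pr neg_in_unary_clone[OF bot n] in auto)
qed

section \<open>The two clones in terms of formulas\<close>

lemma eval_App_Vars: "eval V (App F (map Var [0..<n])) = snd F (map V [0..<n])"
  by (simp add: comp_def)

lemma App_Vars_in_PL: "F \<in> Ops \<Longrightarrow> App F (map Var [0..<fst F]) \<in> PL Ops"
  by (auto simp: PL_def)

lemma clone_le_mono_basis_iff:
  assumes "Ops \<subseteq> BF"
  shows "Ops \<preceq>\<^sub>c mono_basis \<longleftrightarrow> (\<forall>\<phi>\<in>PL Ops. mono_form \<phi>)"
proof
  assume "Ops \<preceq>\<^sub>c mono_basis"
  then have mono: "mono_bf F" if "F \<in> Ops" for F
    using that mono_basis_clone_mono[of F] by (auto simp: clone_le_iff_subset)
  have "eval b \<phi>" if "wf_form Ops \<phi>" "eval a \<phi>" "\<forall>x. a x \<longrightarrow> b x" for \<phi> a b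
    using that
  proof (induction \<phi>)
    case (App F args)
    have "list_all2 (\<longrightarrow>) (map (eval a) args) (map (eval b) args)"
      using App by (auto simp: list_all2_conv_all_nth)
    then show ?case using App.prems mono_bfD[OF mono[of F], of "map (eval a) args"] by simp
  qed auto
  then show "\<forall>\<phi>\<in>PL Ops. mono_form \<phi>" by (auto simp: PL_def mono_form_def)
next
  assume mono: "\<forall>\<phi>\<in>PL Ops. mono_form \<phi>"
  have "F \<in> clone mono_basis" if F: "F \<in> Ops" for F
  proof (rule mono_bf_in_clone)
    show "is_bfun F" using F assms by (auto simp: BF_def)
    \<comment> \<open>\<open>F\<close> is recovered from the formula that applies it to distinct
      variables, so monotonicity of that formula is monotonicity of \<open>F\<close>.\<close>
    show "mono_bf F" unfolding mono_bf_def
    proof (intro allI impI)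
      fix xs ys :: "bool list"
      assume len: "length xs = fst F" and le: "list_all2 (\<longrightarrow>) xs ys" and t: "snd F xs"
      define V where "V zs = (\<lambda>k. k < fst F \<and> zs ! k)" for zs :: "bool list"
      have V: "map (V zs) [0..<fst F] = zs" if "length zs = fst F" for zs
        using that by (auto simp: V_def intro!: nth_equalityI)
      have len': "length ys = fst F" using len list_all2_lengthD[OF le] by simp
      have "\<forall>x. V xs x \<longrightarrow> V ys x" using le len by (auto simp: V_def list_all2_conv_all_nth)
      with mono App_Vars_in_PL[OF F] t V[OF len] V[OF len'] show "snd F ys"
        unfolding mono_form_def by (metis eval_App_Vars)
    qed
  qed
  then show "Ops \<preceq>\<^sub>c mono_basis" by (auto simp: clone_le_iff_subset)
qed

lemma clone_le_unary_basis_iff: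
  assumes "Ops \<subseteq> BF"
  shows "Ops \<preceq>\<^sub>c unary_basis \<longleftrightarrow> (\<forall>\<phi>\<in>PL Ops. unary_form \<phi>)"
proof
  assume "Ops \<preceq>\<^sub>c unary_basis"
  then have unary: "unary_bf F" if "F \<in> Ops" for F
    using that unary_basis_clone_unary[of F] by (auto simp: clone_le_iff_subset)
  have "unary_form \<phi>" if "wf_form Ops \<phi>" for \<phi>
    using that
  proof (induction \<phi>)
    case (Var x)
    show ?case unfolding unary_form_def by (intro exI[of _ x] exI[of _ "\<lambda>c. c"]) simp
  next
    case (App F args)
    then obtain k g where k: "k < fst F" and g: "\<And>xs. length xs = fst F \<Longrightarrow> snd F xs = g (xs ! k)"
      using unary[of F] by (auto simp: unary_bf_def)
    have "args ! k \<in> set args" using k App.prems by auto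
    with App obtain k' g' where "\<forall>V. eval V (args ! k) = g' (V k')"
      unfolding unary_form_def by fastforce
    then show ?case unfolding unary_form_def using App.prems k g
      by (intro exI[of _ k'] exI[of _ "\<lambda>c. g (g' c)"]) auto
  qed
  then show "\<forall>\<phi>\<in>PL Ops. unary_form \<phi>" by (auto simp: PL_def)
next
  assume unary: "\<forall>\<phi>\<in>PL Ops. unary_form \<phi>"
  have "F \<in> clone unary_basis" if F: "F \<in> Ops" for F
  proof (rule unary_bf_in_clone)
    show F': "is_bfun F" using F assms by (auto simp: BF_def)
    from unary App_Vars_in_PL[OF F] obtain k g where
      g: "\<And>V. eval V (App F (map Var [0..<fst F])) = g (V k)"
      unfolding unary_form_def by blast
    have *: "snd F xs = g (k < fst F \<and> xs ! k)" if "length xs = fst F" for xs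
    proof -
      have "map (\<lambda>k. k < fst F \<and> xs ! k) [0..<fst F] = xs"
        using that by (auto intro!: nth_equalityI)
      then show ?thesis using g[of "\<lambda>k. k < fst F \<and> xs ! k"] unfolding eval_App_Vars by simp
    qed
    show "unary_bf F"
    proof (cases "k < fst F")
      case True
      with * show ?thesis unfolding unary_bf_def by auto
    next
      \<comment> \<open>The variable \<open>k\<close> is not an argument of \<open>F\<close>, so
        \<open>F\<close> is constantly \<open>g False\<close> on lists of the right length. Index 0
        is a legitimate choice since the arity is at least 1.\<close>
      case False
      with * F' show ?thesis unfolding unary_bf_def is_bfun_def
        by (intro exI[of _ 0] conjI exI[of _ "\<lambda>_. g False"]) auto
    qed
  qed
  then show "Ops \<preceq>\<^sub>c unary_basis" by (auto simp: clone_le_iff_subset)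
qed

section \<open>Finite characterizations\<close>

definition test_assignments :: "nat set \<Rightarrow> (nat \<Rightarrow> bool) set" where
  "test_assignments S = (\<lambda>(T, c) x. if x \<in> S then x \<in> T else c) ` (Pow S \<times> UNIV)"

lemma test_assignment_extend: "(\<lambda>x. if x \<in> S then V x else c) \<in> test_assignments S"
proof -
  have "(\<lambda>x. if x \<in> S then V x else c) = (\<lambda>(T, c) x. if x \<in> S then x \<in> T else c) ({x\<in>S. V x}, c)"
    by auto
  then show ?thesis unfolding test_assignments_def by blast
qed

lemma finite_test_assignments: "finite S \<Longrightarrow> finite (test_assignments S)"
  by (simp add: test_assignments_def)

lemma card_test_assignments_le: "finite S \<Longrightarrow> card (test_assignments S) \<le> 2 ^ (card S + 1)"
  unfolding test_assignments_def
  by (rule order_trans[OF card_image_le]) (auto simp: card_cartesian_product card_Pow)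

text \<open>Sandwich: \<open>V\<close> lies between its modifications that are constantly
  \<open>False\<close> and constantly \<open>True\<close> off \<open>vars \<phi>\<close>. Both are
  test assignments, and \<phi> has the same value at both as at \<open>V\<close>.\<close>

lemma mono_form_determined:
  assumes "mono_form \<psi>" and agree: "\<And>V. V \<in> test_assignments (vars \<phi>) \<Longrightarrow> eval V \<psi> = eval V \<phi>"
  shows "equiv_form \<psi> \<phi>"
  unfolding equiv_form_def
proof
  fix V :: "nat \<Rightarrow> bool"
  define W where "W c = (\<lambda>x. if x \<in> vars \<phi> then V x else c)" for c
  have "eval (W c) \<psi> = eval V \<phi>" for c
    using agree[OF test_assignment_extend[of "vars \<phi>" V c]] eval_cong[of \<phi> "W c" V] by (auto simp: W_def)
  moreover have "eval (W False) \<psi> \<longrightarrow> eval V \<psi>" "eval V \<psi> \<longrightarrow> eval (W True) \<psi>"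
    using mono_formD[OF assms(1), of "W False" V] mono_formD[OF assms(1), of V "W True"]
    by (simp_all add: W_def split: if_splits)
  ultimately show "eval V \<psi> = eval V \<phi>" by blast
qed

text \<open>If \<psi> reads only the variable \<open>k\<close>, filling the coordinates outside
  \<open>vars \<phi>\<close> with the value \<open>V k\<close> changes neither \<psi> nor \<phi>,
  wherever \<open>k\<close> lies, and the result is a test assignment.\<close>

lemma unary_form_determined:
  assumes "unary_form \<psi>" and agree: "\<And>V. V \<in> test_assignments (vars \<phi>) \<Longrightarrow> eval V \<psi> = eval V \<phi>"
  shows "equiv_form \<psi> \<phi>"
  unfolding equiv_form_def
proof
  fix V :: "nat \<Rightarrow> bool"
  from assms(1) obtain k g where g: "\<And>V. eval V \<psi> = g (V k)" by (auto simp: unary_form_def)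
  define W where "W = (\<lambda>x. if x \<in> vars \<phi> then V x else V k)"
  have "eval V \<psi> = eval W \<psi>" by (simp add: g W_def)
  also have "\<dots> = eval W \<phi>" unfolding W_def by (intro agree test_assignment_extend)
  also have "\<dots> = eval V \<phi>" by (intro eval_cong) (simp add: W_def)
  finally show "eval V \<psi> = eval V \<phi>" .
qed

text \<open>The labelled test assignments already suffice, but their number is only bounded by the
  stated power of two. To reach it exactly, further examples labelled by \<phi> are added; they are
  available because there are infinitely many assignments.\<close>

lemma finite_characterization:
  assumes "\<And>\<psi>. \<psi> \<in> L \<Longrightarrow> mono_form \<psi> \<or> unary_form \<psi>"
  shows "\<exists>E. finite E \<and> card E = 2 ^ (dag_size \<phi> + 1) \<and> uniquely_characterizes E \<phi> L"
proof -
  let ?ex = "\<lambda>V. (V, eval V \<phi>)"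
  define E where "E = ?ex ` test_assignments (vars \<phi>)"
  have fin: "finite E" by (simp add: E_def finite_test_assignments finite_vars)
  have "card E \<le> card (test_assignments (vars \<phi>))"
    unfolding E_def by (intro card_image_le finite_test_assignments finite_vars)
  also have "\<dots> \<le> 2 ^ (card (vars \<phi>) + 1)" by (intro card_test_assignments_le finite_vars)
  also have "\<dots> \<le> 2 ^ (dag_size \<phi> + 1)"
    by (intro power_increasing add_right_mono card_vars_le_dag_size) auto
  finally have le: "card E \<le> 2 ^ (dag_size \<phi> + 1)" .
  have "inj (\<lambda>n::nat. (\<lambda>x. x = n))" by (auto simp: inj_def fun_eq_iff)
  then have "infinite (UNIV :: (nat \<Rightarrow> bool) set)"
    using finite_imageD[of "\<lambda>n::nat. (\<lambda>x. x = n)" UNIV] finite_subset[OF subset_UNIV] infinite_UNIV_nat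
    by blast
  then have "infinite (range ?ex)" using finite_imageD[of ?ex UNIV] by (auto simp: inj_on_def)
  then have "infinite (range ?ex - E)" using fin by (rule Diff_infinite_finite[rotated])
  then obtain B where B: "finite B" "card B = 2 ^ (dag_size \<phi> + 1) - card E" "B \<subseteq> range ?ex - E"
    using infinite_arbitrarily_large by blast
  have "card (E \<union> B) = 2 ^ (dag_size \<phi> + 1)"
    using B le fin by (subst card_Un_disjoint) auto
  moreover have "uniquely_characterizes (E \<union> B) \<phi> L"
    unfolding uniquely_characterizes_def
  proof (intro conjI ballI impI)
    fix e assume "e \<in> E \<union> B"
    then show "fits \<phi> e" using B by (auto simp: E_def fits_def)
  next
    fix \<psi> assume "\<psi> \<in> L" and fits: "\<forall>e\<in>E \<union> B. fits \<psi> e"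
    have "eval V \<psi> = eval V \<phi>" if "V \<in> test_assignments (vars \<phi>)" for V
    proof -
      have "?ex V \<in> E \<union> B" using that by (simp add: E_def)
      then have "fits \<psi> (?ex V)" using fits by blast
      then show ?thesis by (simp add: fits_def)
    qed
    with assms[OF \<open>\<psi> \<in> L\<close>] show "equiv_form \<psi> \<phi>"
      using mono_form_determined unary_form_determined by blast
  qed
  ultimately show ?thesis using fin B by blast
qed

section \<open>Degenerate operations\<close>

text \<open>Four places are enough: the substitutions in \<open>ex_degenerate_realized\<close> sort
  the variables of a formula into at most four classes according to their values in two
  assignments.\<close>

type_synonym op4 = "bool \<Rightarrow> bool \<Rightarrow> bool \<Rightarrow> bool \<Rightarrow> bool"

definition degenerate :: "op4 \<Rightarrow> bool" where
  "degenerate h \<longleftrightarrow> (\<forall>u p q w. h u p p w = h u q q w) \<and> (\<exists>u p q w. h u p q w \<noteq> h u p p w)"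

locale op4_clone =
  fixes T :: "op4 set"
  assumes proj1: "(\<lambda>x y z w. x) \<in> T" and proj2: "(\<lambda>x y z w. y) \<in> T"
    and proj3: "(\<lambda>x y z w. z) \<in> T" and proj4: "(\<lambda>x y z w. w) \<in> T"
    and comp: "f \<in> T \<Longrightarrow> a \<in> T \<Longrightarrow> b \<in> T \<Longrightarrow> c \<in> T \<Longrightarrow> d \<in> T \<Longrightarrow>
      (\<lambda>x y z w. f (a x y z w) (b x y z w) (c x y z w) (d x y z w)) \<in> T"
begin

lemma op_cong: "f \<in> T \<Longrightarrow> (\<And>x y z w. f x y z w = g x y z w) \<Longrightarrow> g \<in> T"
  by (subgoal_tac "f = g") (auto intro!: ext)

text \<open>With \<open>False\<close> and \<open>True\<close> passed as arguments, raising the third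
  argument lowers the value. The case analysis is on the diagonal \<open>g x x x\<close>: it is a
  constant, the negation, or the identity. A constant replaces one of the two fixed
  arguments.\<close>

lemma nonmono_degenerate_or_neg:
  assumes f: "f \<in> T" and f1: "f False True False False" and f2: "\<not> f False True True False"
  shows "(\<exists>h\<in>T. degenerate h) \<or> (\<lambda>x y z w. \<not> x) \<in> T"
proof -
  define g where "g x y z = f x y z x" for x y z
  have g1: "g False True False" and g2: "\<not> g False True True"
    using f1 f2 by (auto simp: g_def)
  have g: "(\<lambda>x y z w. g (a x y z w) (b x y z w) (c x y z w)) \<in> T"
    if "a \<in> T" "b \<in> T" "c \<in> T" for a b c
    using comp[OF f that(1,2,3,1)] by (simp add: g_def)
  have zero: ?thesis if z: "(\<lambda>x y z w. False) \<in> T"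
  proof (cases "g False False False")
    case True
    then have "g False x x = (\<not> x)" for x using g2 by (cases x) simp_all
    then have "(\<lambda>x y z w. \<not> x) \<in> T" by (rule op_cong[OF g[OF z proj1 proj1]])
    then show ?thesis ..
  next
    case False
    then have "degenerate (\<lambda>x y z w. g False y z)"
      using g1 g2 by (simp add: degenerate_def all_bool_eq ex_bool_eq)
    then show ?thesis using g[OF z proj2 proj3] by blast
  qed
  have one: ?thesis if o: "(\<lambda>x y z w. True) \<in> T"
  proof (cases "g True True True")
    case False
    then have "g x True x = (\<not> x)" for x using g1 by (cases x) simp_all
    then have "(\<lambda>x y z w. \<not> x) \<in> T" by (rule op_cong[OF g[OF proj1 o proj1]])
    then show ?thesis ..
  next
    case True
    then have "degenerate (\<lambda>x y z w. g y True z)"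
      using g1 g2 by (simp add: degenerate_def all_bool_eq ex_bool_eq)
    then show ?thesis using g[OF proj2 o proj3] by blast
  qed
  have diag: "(\<lambda>x y z w. g x x x) \<in> T" by (rule g[OF proj1 proj1 proj1])
  consider "g False False False" "g True True True" | "\<not> g False False False" "\<not> g True True True"
    | "g False False False" "\<not> g True True True" | "\<not> g False False False" "g True True True"
    by blast
  then show ?thesis
  proof cases
    case 1
    then have "g x x x = True" for x by (cases x) simp_all
    then have "(\<lambda>x y z w. True) \<in> T" by (rule op_cong[OF diag])
    then show ?thesis by (rule one)
  next
    case 2
    then have "g x x x = False" for x by (cases x) simp_all
    then have "(\<lambda>x y z w. False) \<in> T" by (rule op_cong[OF diag])
    then show ?thesis by (rule zero)
  next
    case 3
    then have "g x x x = (\<not> x)" for x by (cases x) simp_all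
    then have "(\<lambda>x y z w. \<not> x) \<in> T" by (rule op_cong[OF diag])
    then show ?thesis ..
  next
    case 4
    note vals = g1 g2 4
    show ?thesis
    proof (cases "\<not> g True False True \<or> g True False False")
      case True
      \<comment> \<open>For \<open>y = z\<close> the first candidate equals \<open>x\<close> if
        \<open>g True False True\<close> fails, and the second equals \<open>x\<close> if
        \<open>g True False False\<close> holds. Off the diagonal, \<open>g1\<close> and
        \<open>g2\<close> give a different value.\<close>
      then have "degenerate (\<lambda>x y z w. g y x z) \<or> degenerate (\<lambda>x y z w. g x y z)"
        using vals by (auto simp: degenerate_def all_bool_eq ex_bool_eq)
      then show ?thesis using g[OF proj2 proj1 proj3] g[OF proj1 proj2 proj3] by blast
    next
      case False
      \<comment> \<open>Here \<open>g x y x\<close> is \<open>x \<or> y\<close> and \<open>g x y y\<close> is \<open>x \<and> y\<close>, so the first two candidates are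
        \<open>g x y z \<or> x\<close> and \<open>g y x z \<and> x\<close>; they equal \<open>x \<or> (y \<and> \<not> z)\<close> if \<open>g False False True\<close> fails,
        and \<open>x \<and> (y \<or> \<not> z)\<close> if \<open>g True True False\<close> holds.\<close>
      have "degenerate (\<lambda>x y z w. g (g x y z) x (g x y z)) \<or> degenerate (\<lambda>x y z w. g (g y x z) x x)
          \<or> degenerate (\<lambda>x y z w. g y z x)"
      proof -
        consider "\<not> g False False True" | "g True True False" | "g False False True" "\<not> g True True False"
          by blast
        then show ?thesis
          using False vals by cases (simp_all add: degenerate_def all_bool_eq ex_bool_eq)
      qed
      then show ?thesis
        using g[OF g[OF proj1 proj2 proj3] proj1 g[OF proj1 proj2 proj3]]
          g[OF g[OF proj2 proj1 proj3] proj1 proj1] g[OF proj2 proj3 proj1] by blast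
    qed
  qed
qed

end

section \<open>Clones with negation and two essential variables\<close>

locale op4_clone_neg = op4_clone +
  assumes neg: "(\<lambda>x y z w. \<not> x) \<in> T"
begin

lemma neg_closed: "a \<in> T \<Longrightarrow> (\<lambda>x y z w. \<not> a x y z w) \<in> T"
  using comp[OF neg, of a a a a] by simp

text \<open>The argument \<open>u\<close> plays the role of a constant: when no constants are available, self-duality
  transfers what happens at \<open>u = False\<close> to \<open>u = True\<close>.\<close>

lemma face_degenerate:
  assumes B: "B \<in> T"
    and bal: "(\<forall>p q u w. B p q u w = B p q False False) \<or>
      (\<forall>p q u w w'. B p q u w = (\<not> B (\<not> p) (\<not> q) (\<not> u) w'))"
    and diag: "B False False False False = B True True False False \<or>
      B False True False False = B True False False False"
    and nonconst: "B p q False False \<noteq> B p' q' False False"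
  shows "\<exists>h\<in>T. degenerate h"
proof -
  have nonconst': "\<not> (B False False False False = B False True False False \<and>
      B False False False False = B True False False False \<and> B False False False False = B True True False False)"
    using nonconst by (metis (full_types))
  \<comment> \<open>If \<open>B\<close> agrees at the two points with \<open>p = q\<close>, it
    serves itself; if it agrees at the two points with \<open>p \<noteq> q\<close>, negating
    \<open>q\<close> exchanges the diagonals. In both cases non-constancy provides a differing value
    on the other diagonal.\<close>
  have "degenerate (\<lambda>u p q w. B p q u w) \<or> degenerate (\<lambda>u p q w. B p (\<not> q) u w)"
    using bal
  proof
    assume *: "\<forall>p q u w. B p q u w = B p q False False"
    define b where "b p q = B p q False False" for p q
    have "B = (\<lambda>p q u w. b p q)" using * by (auto simp: fun_eq_iff b_def)
    then show ?thesis using diag nonconst'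
      by (cases "b False False"; cases "b False True"; cases "b True False"; cases "b True True")
        (simp_all add: degenerate_def all_bool_eq ex_bool_eq)
  next
    assume *: "\<forall>p q u w w'. B p q u w = (\<not> B (\<not> p) (\<not> q) (\<not> u) w')"
    define b where "b p q = B p q False False" for p q
    have "B p q u w = (if u then \<not> b (\<not> p) (\<not> q) else b p q)" for p q u w
    proof (cases u)
      case True
      then show ?thesis using *[rule_format, of p q u w False] by (simp add: b_def)
    next
      case False
      then show ?thesis using *[rule_format, of p q u w False]
          *[rule_format, of "\<not> p" "\<not> q" True False False] by (simp add: b_def)
    qed
    then have "B = (\<lambda>p q u w. if u then \<not> b (\<not> p) (\<not> q) else b p q)" by (intro ext)
    then show ?thesis using diag nonconst'
      by (cases "b False False"; cases "b False True"; cases "b True False"; cases "b True True")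
        (simp_all add: degenerate_def all_bool_eq ex_bool_eq)
  qed
  then show ?thesis
    using comp[OF B proj2 proj3 proj1 proj4] comp[OF B proj2 neg_closed[OF proj3] proj1 proj4] by blast
qed

text \<open>At \<open>u = False\<close> the function \<open>t\<close> lives on a three-dimensional
  cube in \<open>x\<close>, \<open>y\<close>, \<open>w\<close>. If no face function were degenerate,
  then on each of three faces, where \<open>t\<close> is not constant, opposite corners would have
  different values; together with \<open>x\<close> and \<open>y\<close> this is impossible.\<close>

lemma two_essential_degenerate:
  assumes t: "t \<in> T" and x: "t False False False False \<noteq> t True False False False"
    and y: "t False False False True \<noteq> t False True False True"
  shows "\<exists>h\<in>T. degenerate h"
proof -
  define dual where "dual \<longleftrightarrow> (\<forall>x y u w. t x y u w = (\<not> t (\<not> x) (\<not> y) (\<not> u) (\<not> w)))"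
  \<comment> \<open>\<open>z u\<close> is a substitute for the constant \<open>False\<close>,
    correct at \<open>u = False\<close>. It is a genuine constant unless \<open>t\<close> is
    self-dual, in which case \<open>u\<close> itself is used.\<close>
  obtain z where z: "(\<lambda>x y u w. z u) \<in> T" and z0: "\<not> z False" and zT: "z True \<longrightarrow> dual"
  proof (cases dual)
    case True
    with that[of "\<lambda>u. u"] proj3 show ?thesis by simp
  next
    case False
    then obtain x y u w where eq: "t x y u w = t (\<not> x) (\<not> y) (\<not> u) (\<not> w)"
      by (auto simp: dual_def)
    \<comment> \<open>A function that is not self-dual takes equal values at some point and its
      complement. Feeding it \<open>v\<close> or the negation of \<open>v\<close> in each place
      visits just these two points and yields a constant.\<close>
    have lit: "(\<lambda>v _ _ _. v = c) \<in> T" for c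
      using proj1 neg by (cases c) simp_all
    have "(\<lambda>v _ _ _. t (v = x) (v = y) (v = u) (v = w)) \<in> T"
      by (rule comp[OF t lit lit lit lit])
    moreover have "t (v = x) (v = y) (v = u) (v = w) = t x y u w" for v
      using eq by (cases v) auto
    ultimately have const: "(\<lambda>_ _ _ _. t x y u w) \<in> T" by (rule op_cong)
    have "(\<lambda>_ _ _ _. False) \<in> T"
    proof (cases "t x y u w")
      case True
      then show ?thesis using neg_closed[OF const] by simp
    qed (use const in simp)
    with that[of "\<lambda>_. False"] show ?thesis by simp
  qed
  have zcases: "z = (\<lambda>u. False) \<or> z = (\<lambda>u. u) \<and> dual"
    using z0 zT by (cases "z True") (simp_all add: fun_eq_iff all_bool_eq)
  let ?A = "\<lambda>p q u w. t p (z u) (z u) q" and ?B = "\<lambda>p q u w. t (z u) p (z u) q"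
    and ?C = "\<lambda>p q u w. t p q (z u) (z u)"
  show ?thesis
  proof (rule ccontr)
    assume no: "\<not> ?thesis"
    have A: "?A \<in> T" "?B \<in> T" "?C \<in> T"
      by (rule comp[OF t proj1 z z proj2] comp[OF t z proj1 z proj2] comp[OF t proj1 proj2 z z])+
    \<comment> \<open>A constant \<open>z\<close> removes \<open>u\<close> from the face functions;
      for \<open>z u = u\<close> they inherit the self-duality of \<open>t\<close>.\<close>
    have bal: "(\<forall>p q u w. F p q u w = F p q False False) \<or>
        (\<forall>p q u w w'. F p q u w = (\<not> F (\<not> p) (\<not> q) (\<not> u) w'))" if "F \<in> {?A, ?B, ?C}" for F
      using zcases
    proof
      assume "z = (\<lambda>u. False)"
      with that show ?thesis by auto
    next
      assume "z = (\<lambda>u. u) \<and> dual"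
      then have "z = (\<lambda>u. u)" and d: "\<And>x y u w. t x y u w = (\<not> t (\<not> x) (\<not> y) (\<not> u) (\<not> w))"
        unfolding dual_def by blast+
      with that have "\<forall>p q u w w'. F p q u w = (\<not> F (\<not> p) (\<not> q) (\<not> u) w')"
        by (elim insertE emptyE; hypsubst) (intro allI; rule d)+
      then show ?thesis by blast
    qed
    have bal': "F False False False False \<noteq> F True True False False \<and>
        F False True False False \<noteq> F True False False False"
      if "F \<in> {?A, ?B, ?C}" "F p q False False \<noteq> F p' q' False False" for F p q p' q'
      using face_degenerate[OF _ bal[OF that(1)] _ that(2)] that(1) A no by blast
    have face_xw: "t False False False False \<noteq> t True False False True"
        "t False False False True \<noteq> t True False False False"
      using bal'[of ?A False False True False] x z0 by auto
    have face_yw: "t False False False False \<noteq> t False True False True"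
        "t False False False True \<noteq> t False True False False"
      using bal'[of ?B False True True True] y z0 by auto
    have face_xy: "t False False False False \<noteq> t True True False False"
        "t False True False False \<noteq> t True False False False"
      using bal'[of ?C False False True False] x z0 by auto
    \<comment> \<open>Let \<open>c\<close> be the value of \<open>t\<close> at the origin. Then
      \<open>t\<close> is \<not> \<open>c\<close> at \<open>x\<close> alone, hence \<open>c\<close>
      at \<open>w\<close> alone by \<open>face_xw\<close>, hence \<not> \<open>c\<close> at
      \<open>y\<close> alone by \<open>face_yw\<close>; but \<open>face_xy\<close> forbids equal
      values at \<open>x\<close> alone and \<open>y\<close> alone.\<close>
    from x y face_xw face_yw face_xy show False by argo
  qed
qed

end

section \<open>Formulas without a finite characterization\<close>

definition realized :: "bfun set \<Rightarrow> op4 set" where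
  "realized Ops = {t. \<exists>\<phi>\<in>PL Ops. \<forall>V. eval V \<phi> = t (V 0) (V 1) (V 2) (V 3)}"

text \<open>Each function \<open>s n\<close> is replaced by a formula realizing it, and these
  formulas are substituted simultaneously for the variables of \<phi>.\<close>

lemma realized_subst:
  assumes "\<phi> \<in> PL Ops" "\<And>n. s n \<in> realized Ops"
  shows "(\<lambda>x y z w. eval (\<lambda>n. s n x y z w) \<phi>) \<in> realized Ops"
proof -
  from assms(2) have "\<forall>n. \<exists>\<psi>. \<psi> \<in> PL Ops \<and> (\<forall>V. eval V \<psi> = s n (V 0) (V 1) (V 2) (V 3))"
    by (auto simp: realized_def)
  then obtain \<sigma> where \<sigma>: "\<sigma> n \<in> PL Ops" "eval V (\<sigma> n) = s n (V 0) (V 1) (V 2) (V 3)" for n V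
    by metis
  have "subst_form \<sigma> \<phi> \<in> PL Ops" using assms(1) \<sigma>(1) by (rule subst_form_in_PL)
  moreover have "\<forall>V. eval V (subst_form \<sigma> \<phi>) = eval (\<lambda>n. s n (V 0) (V 1) (V 2) (V 3)) \<phi>"
    by (simp add: eval_subst_form \<sigma>(2))
  ultimately show ?thesis unfolding realized_def by blast
qed

lemma realized_proj:
  "(\<lambda>x y z w. x) \<in> realized Ops" "(\<lambda>x y z w. y) \<in> realized Ops"
  "(\<lambda>x y z w. z) \<in> realized Ops" "(\<lambda>x y z w. w) \<in> realized Ops"
  unfolding realized_def mem_Collect_eq
  by (rule bexI[OF _ Var_in_PL[of 0]] bexI[OF _ Var_in_PL[of 1]]
      bexI[OF _ Var_in_PL[of 2]] bexI[OF _ Var_in_PL[of 3]], simp; fail)+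

interpretation realized: op4_clone "realized Ops" for Ops
proof (unfold_locales; (rule realized_proj)?)
  fix f a b c d
  assume f: "f \<in> realized Ops" and ab: "a \<in> realized Ops" "b \<in> realized Ops" "c \<in> realized Ops" "d \<in> realized Ops"
  from f obtain \<phi> where \<phi>: "\<phi> \<in> PL Ops" "\<And>V. eval V \<phi> = f (V 0) (V 1) (V 2) (V 3)"
    by (auto simp: realized_def)
  define s where "s n = (if n = 0 then a else if n = 1 then b else if n = 2 then c else d)" for n :: nat
  have "s n \<in> realized Ops" for n using ab by (simp add: s_def)
  from realized_subst[of \<phi> Ops s, OF \<phi>(1) this]
  show "(\<lambda>x y z w. f (a x y z w) (b x y z w) (c x y z w) (d x y z w)) \<in> realized Ops"
    by (simp add: \<phi>(2) s_def)
qed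

text \<open>Two stages: the non-monotone formula yields a degenerate operation or negation, and once
  negation is available the two essential variables of \<psi> yield a degenerate operation.\<close>

lemma ex_degenerate_realized:
  assumes nonmono: "\<phi> \<in> PL Ops" "\<not> mono_form \<phi>" and nonunary: "\<psi> \<in> PL Ops" "\<not> unary_form \<psi>"
  shows "\<exists>h\<in>realized Ops. degenerate h"
proof (rule ccontr)
  assume no: "\<not> ?thesis"
  from nonmono(2) obtain a b where ab: "\<And>x. a x \<Longrightarrow> b x" "eval a \<phi>" "\<not> eval b \<phi>"
    by (auto simp: mono_form_def)
  \<comment> \<open>Since \<open>a\<close> lies below \<open>b\<close>, a coordinate is true in
    both, only in \<open>b\<close>, or in neither; these classes receive \<open>y\<close>,
    \<open>z\<close> and \<open>x\<close>. Thus \<open>x = False\<close>, \<open>y = True\<close>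
    gives \<open>a\<close> for \<open>z = False\<close> and \<open>b\<close> for
    \<open>z = True\<close>.\<close>
  define s :: "nat \<Rightarrow> op4" where
    "s n = (\<lambda>x y z w. if a n then y else if b n then z else x)" for n
  have s: "s n \<in> realized Ops" for n using realized_proj[of Ops] unfolding s_def by (cases "a n"; cases "b n") simp_all
  have "(\<lambda>n. s n False True False False) = a" "(\<lambda>n. s n False True True False) = b"
    using ab(1) by (auto simp: s_def)
  then have "(\<lambda>x y z w. \<not> x) \<in> realized Ops"
    using realized.nonmono_degenerate_or_neg[OF realized_subst[of \<phi> Ops s, OF nonmono(1) s]] ab(2,3) no
    by auto
  then interpret neg: op4_clone_neg "realized Ops" by unfold_locales
  from nonunary(2) obtain i j a b where ij: "i \<noteq> j"
    and i: "eval a \<psi> \<noteq> eval (a(i := \<not> a i)) \<psi>" and j: "eval b \<psi> \<noteq> eval (b(j := \<not> b j)) \<psi>"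
    by (rule not_unary_form_depends)
  \<comment> \<open>The substitution sends \<open>(x, y, u, w)\<close> to a variation of \<open>a\<close> in coordinate \<open>i\<close> when
    \<open>y = u = w = False\<close>, and to a variation of \<open>b\<close> in coordinate \<open>j\<close> when \<open>x = u = False\<close>, \<open>w = True\<close>.\<close>
  define r :: "nat \<Rightarrow> op4" where
    "r n = (if n = i then (\<lambda>x y u w. x \<noteq> b i) else if n = j then (\<lambda>x y u w. y \<noteq> a j)
       else if a n = b n then (\<lambda>x y u w. u \<noteq> a n) else (\<lambda>x y u w. w \<noteq> a n))" for n
  have lit: "(\<lambda>x y u w. x \<noteq> c) \<in> realized Ops" "(\<lambda>x y u w. y \<noteq> c) \<in> realized Ops"
    "(\<lambda>x y u w. u \<noteq> c) \<in> realized Ops" "(\<lambda>x y u w. w \<noteq> c) \<in> realized Ops" for c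
    using realized_proj[THEN neg.neg_closed] realized_proj by (cases c; simp)+
  have r: "r n \<in> realized Ops" for n
    unfolding r_def by (intro lit | split if_split | intro conjI impI)+
  have ra: "(\<lambda>n. r n x False False False) = a(i := (x \<noteq> b i))" for x
    by (auto simp: r_def fun_eq_iff)
  have rb: "(\<lambda>n. r n False y False True) = b(j := (y \<noteq> a j))" for y
    using ij by (auto simp: r_def fun_eq_iff)
  have "eval (a(i := c)) \<psi> \<noteq> eval (a(i := \<not> c)) \<psi>" for c
    using i by (cases "c = a i") (auto simp: fun_upd_idem)
  from this[of "b i"] have "eval (\<lambda>n. r n False False False False) \<psi> \<noteq> eval (\<lambda>n. r n True False False False) \<psi>"
    unfolding ra by simp
  moreover have "eval (b(j := c)) \<psi> \<noteq> eval (b(j := \<not> c)) \<psi>" for c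
    using j by (cases "c = b j") (auto simp: fun_upd_idem)
  from this[of "a j"] have "eval (\<lambda>n. r n False False False True) \<psi> \<noteq> eval (\<lambda>n. r n False True False True) \<psi>"
    unfolding rb by simp
  ultimately have "\<exists>h\<in>realized Ops. degenerate h"
    by (rule neg.two_essential_degenerate[OF realized_subst[of \<psi> Ops r, OF nonunary(1) r]])
  with no show False by (rule notE)
qed

text \<open>The formula is chosen before \<open>N\<close>, and only \<open>P\<close> grows with
  \<open>N\<close>. Hence the size of the formula stays fixed, which is what refutes a bound
  depending on that size alone.\<close>

lemma degenerate_not_characterized:
  assumes h: "h \<in> realized Ops" "degenerate h"
  shows "\<exists>\<phi>\<in>PL Ops. \<forall>N. \<exists>P. finite P \<and> \<phi> \<in> PL_prop Ops P \<and>
    (\<forall>E. finite E \<longrightarrow> card E \<le> N \<longrightarrow> \<not> uniquely_characterizes E \<phi> (PL_prop Ops P))"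
proof -
  from h(1) obtain \<chi> where \<chi>: "\<chi> \<in> PL Ops" and eval_\<chi>: "\<And>V. eval V \<chi> = h (V 0) (V 1) (V 2) (V 3)"
    by (auto simp: realized_def)
  from h(2) obtain u p q w where indep: "\<And>u p q w. h u p p w = h u q q w" and dep: "h u p q w \<noteq> h u p p w"
    unfolding degenerate_def by blast
  define rename where "rename k l = subst_form (\<lambda>n. Var (if n = 1 then k else if n = 2 then l else n)) \<chi>" for k l
  have rename_PL: "rename k l \<in> PL Ops" for k l
    unfolding rename_def using \<chi> Var_in_PL by (rule subst_form_in_PL)
  have eval_rename: "eval V (rename k l) = h (V 0) (V k) (V l) (V 3)" for V k l
    by (simp add: rename_def eval_subst_form eval_\<chi>)
  have vars_rename: "vars (rename k l) \<subseteq> vars \<chi> \<union> {k, l}" for k l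
    by (auto simp: rename_def vars_subst_form)
  show ?thesis
  proof (intro bexI[of _ "rename 1 1"] allI)
    fix N :: nat
    \<comment> \<open>The fresh variables start at 4 to avoid the variables 0 to 3 that carry the
      arguments of \<open>h\<close>. There is one more of them than the at most \<open>2 ^ N\<close>
      subsets of \<open>E\<close>.\<close>
    define Q where "Q = {4..<4 + (2 ^ N + 1 :: nat)}"
    define P where "P = vars \<chi> \<union> {1} \<union> Q"
    have rename_P: "rename k l \<in> PL_prop Ops P" if "k \<in> P" "l \<in> P" for k l
      using that rename_PL[of k l] vars_rename[of k l] by (auto simp: PL_prop_def PL_def P_def)
    have "\<not> uniquely_characterizes E (rename 1 1) (PL_prop Ops P)" if E: "finite E" "card E \<le> N" for E
    proof
      assume uc: "uniquely_characterizes E (rename 1 1) (PL_prop Ops P)"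
      \<comment> \<open>The column of \<open>v\<close> records which examples make \<open>v\<close>
        true; two variables with equal columns are indistinguishable on \<open>E\<close>.\<close>
      let ?col = "\<lambda>v. {e \<in> E. fst e v}"
      have "card (?col ` Q) \<le> card (Pow E)"
        using E by (intro card_mono) auto
      also have "\<dots> \<le> 2 ^ N" using E by (simp add: card_Pow)
      also have "\<dots> < card Q" by (simp add: Q_def)
      finally have "\<not> inj_on ?col Q" by (rule pigeonhole)
      then obtain k l where kl: "k \<in> Q" "l \<in> Q" "k \<noteq> l" and col: "?col k = ?col l"
        unfolding inj_on_def by blast
      have "fst e k = fst e l" if "e \<in> E" for e using col that by blast
      then have "fits (rename k l) e" if "e \<in> E" for e
        using uc that indep[of "fst e 0" "fst e l" "fst e 3" "fst e 1"]
        by (auto simp: uniquely_characterizes_def fits_def eval_rename)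
      then have "equiv_form (rename k l) (rename 1 1)"
        using uc rename_P[of k l] kl by (auto simp: uniquely_characterizes_def P_def)
      \<comment> \<open>The assignment realizes the failure \<open>dep\<close>: \<open>l\<close>
        receives \<open>q\<close>, while both \<open>k\<close> and the fixed variable 1 receive
        \<open>p\<close>. No values clash, because \<open>k\<close> and \<open>l\<close> are
        distinct and at least 4.\<close>
      moreover define V where "V n = (if n = 0 then u else if n = 3 then w else if n = l then q else p)" for n
      ultimately have "eval V (rename k l) = eval V (rename 1 1)" by (simp add: equiv_form_def)
      moreover have "V 0 = u" "V k = p" "V l = q" "V 3 = w" "V 1 = p"
        using kl by (auto simp: V_def Q_def)
      ultimately show False using dep by (simp add: eval_rename)
    qed
    then show "\<exists>P. finite P \<and> rename 1 1 \<in> PL_prop Ops P \<and>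
        (\<forall>E. finite E \<longrightarrow> card E \<le> N \<longrightarrow> \<not> uniquely_characterizes E (rename 1 1) (PL_prop Ops P))"
      using rename_P[of 1 1] finite_vars[of \<chi>] by (intro exI[of _ P]) (auto simp: P_def Q_def)
  qed (rule rename_PL)
qed

theorem theorem3p19:
  fixes Ops :: "bfun set"
  assumes "Ops \<subseteq> BF"
  shows "((Ops \<preceq>\<^sub>c {and_bf, or_bf, top_bf, bot_bf} \<or> Ops \<preceq>\<^sub>c {neg_bf, bot_bf})
           \<longleftrightarrow> (\<forall>\<phi> \<in> PL Ops. \<exists>E. finite E \<and> uniquely_characterizes E \<phi> (PL Ops)))
       \<and> ((\<forall>\<phi> \<in> PL Ops. \<exists>E. finite E \<and> uniquely_characterizes E \<phi> (PL Ops))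
           \<longleftrightarrow> (\<exists>f :: nat \<Rightarrow> nat. \<forall>P. finite P \<longrightarrow>
                 (\<forall>\<phi> \<in> PL_prop Ops P. \<exists>E. finite E \<and> card E = f (dag_size \<phi>) \<and>
                     uniquely_characterizes E \<phi> (PL_prop Ops P))))"
  (is "(?one \<longleftrightarrow> ?two) \<and> (_ \<longleftrightarrow> ?three)")
proof -
  have PL_prop_subset: "PL_prop Ops P \<subseteq> PL Ops" for P by (auto simp: PL_prop_def PL_def)
  have pos: "?two \<and> ?three" if ?one
  proof -
    have "mono_form \<psi> \<or> unary_form \<psi>" if "\<psi> \<in> PL Ops" for \<psi>
      using \<open>?one\<close> that clone_le_mono_basis_iff[OF assms] clone_le_unary_basis_iff[OF assms] by blast
    then have *: "\<exists>E. finite E \<and> card E = 2 ^ (dag_size \<phi> + 1) \<and> uniquely_characterizes E \<phi> L"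
      if "L \<subseteq> PL Ops" for \<phi> L
      using finite_characterization[of L \<phi>] that by blast
    have ?two using *[OF subset_refl] by blast
    moreover have ?three using *[OF PL_prop_subset] by (intro exI[of _ "\<lambda>d. 2 ^ (d + 1)"]) blast
    ultimately show ?thesis ..
  qed
  have neg: "\<not> ?two \<and> \<not> ?three" if not1: "\<not> ?one"
  proof -
    obtain h where "h \<in> realized Ops" "degenerate h"
      using not1 clone_le_mono_basis_iff[OF assms] clone_le_unary_basis_iff[OF assms]
        ex_degenerate_realized[of _ Ops] by blast
    then obtain \<phi> where \<phi>: "\<phi> \<in> PL Ops" and bad: "\<And>N. \<exists>P. finite P \<and> \<phi> \<in> PL_prop Ops P \<and>
        (\<forall>E. finite E \<longrightarrow> card E \<le> N \<longrightarrow> \<not> uniquely_characterizes E \<phi> (PL_prop Ops P))"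
      using degenerate_not_characterized by blast
    \<comment> \<open>A characterization with respect to all formulas remains one with respect to
      each \<open>PL_prop Ops P\<close>, so the set \<open>P\<close> found for
      \<open>N = card E\<close> gives a contradiction.\<close>
    have "\<not> uniquely_characterizes E \<phi> (PL Ops)" if "finite E" for E
    proof
      assume "uniquely_characterizes E \<phi> (PL Ops)"
      then have "uniquely_characterizes E \<phi> (PL_prop Ops P)" for P
        using PL_prop_subset[of P] unfolding uniquely_characterizes_def by blast
      with bad[of "card E"] that show False by blast
    qed
    with \<phi> have "\<not> ?two" by blast
    moreover have "\<not> ?three"
    proof
      assume ?three
      then obtain f where f: "\<forall>P. finite P \<longrightarrow> (\<forall>\<phi> \<in> PL_prop Ops P. \<exists>E. finite E \<and>
          card E = f (dag_size \<phi>) \<and> uniquely_characterizes E \<phi> (PL_prop Ops P))"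
        by (elim exE)
      from bad[of "f (dag_size \<phi>)"] obtain P where P: "finite P" "\<phi> \<in> PL_prop Ops P"
        and no: "\<forall>E. finite E \<longrightarrow> card E \<le> f (dag_size \<phi>) \<longrightarrow> \<not> uniquely_characterizes E \<phi> (PL_prop Ops P)"
        by blast
      from f P obtain E where "finite E" "card E = f (dag_size \<phi>)" "uniquely_characterizes E \<phi> (PL_prop Ops P)"
        by blast
      with no show False by simp
    qed
    ultimately show ?thesis ..
  qed
  from pos neg show ?thesis by blast
qed

end
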